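(* There is a monoidal natural transformation $\mathsf{flow}\colon\mathsf{Opt}\Rightarrow\mathsf{Dynam}$ whose component at a finite set $N$, $\mathsf{flow}_N\colon\mathsf{Opt}(N)\to\mathsf{Dynam}(N)$, is defined by $\mathsf{flow}_N(f)=\bigl(x\mapsto-\nabla f(x)\bigr)$.
   Context: For a finite set $N$, $\mathbb{R}^N$ is the vector space of functions $N\to\mathbb{R}$. For a function $\phi\colon N\to M$ of finite sets, the pullback $\phi^*\colon\mathbb{R}^M\to\mathbb{R}^N$ is $\phi^*(y)_i=y_{\phi(i)}$ and the pushforward $\phi_*\colon\mathbb{R}^N\to\mathbb{R}^M$ is $\phi_*(x)_j=\sum_{i\in\phi^{-1}(j)}x_i$. $\iota_N\colon N\to N+M$ and $\iota_M\colon M\to N+M$ denote the inclusions into the disjoint union. $(\mathbf{FinSet},+)$ has disjoint union as monoidal product, $(\mathbf{Set},\times)$ has Cartesian product. $C^1$ denotes once-continuously-differentiable functions. $\mathsf{Opt}\colon(\mathbf{FinSet},+)\to(\mathbf{Set},\times)$ is the lax symmetric monoidal functor with $\mathsf{Opt}(N)=\{f\colon\mathbb{R}^N\to\mathbb{R}\mid f\in C^1\}$; $\mathsf{Opt}(\phi)(f)=f\circ\phi^*$; product comparison $(f,g)\mapsto f\circ\iota_N^*+g\circ\iota_M^*$; unit comparison picking the zero function on $\mathbb{R}^0$. $\mathsf{Dynam}\colon(\mathbf{FinSet},+)\to(\mathbf{Set},\times)$ is the lax symmetric monoidal functor with $\mathsf{Dynam}(N)$ the set of smooth maps $\upsilon\colon\mathbb{R}^N\to\mathbb{R}^N$;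 $\mathsf{Dynam}(\phi)(\upsilon)=\phi_*\circ\upsilon\circ\phi^*$; product comparison $(\upsilon,\rho)\mapsto\iota_{N*}\circ\upsilon\circ\iota_N^*+\iota_{M*}\circ\rho\circ\iota_M^*$; unit comparison the unique map $\{*\}\to\mathsf{Dynam}(\emptyset)$.
   Formalization: The negative gradient of a C^1 function need not be smooth (e.g. x|x|), so flow is stated from C^{k+1} functions to C^k vector fields for every k in {0,1,...,∞}; k=0 keeps Opt as C^1 functions with continuous fields, k=∞ keeps Dynam as smooth fields with smooth functions. *)

theory Defs
  imports "HOL-Analysis.Analysis" "HOL-Library.Extended_Nat"
begin

section \<open>The category of finite sets with disjoint union\<close>

text \<open>
  An object of FinSet is a finite set of points of type \<open>'a pt\<close>.  This type contains a copy of
  every set of type \<open>'a set\<close> and is closed under tagged disjoint union, which makes the disjoint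
  union an operation on objects.  Morphisms \<open>N \<rightarrow> M\<close> are the elements of \<open>N \<rightarrow>\<^sub>E M\<close>, that is,
  functions that are \<open>undefined\<close> outside \<open>N\<close>, so that equality of morphisms is HOL equality;
  composition is \<open>compose N\<close>.
\<close>

datatype 'a pt = Atom 'a | InL "'a pt" | InR "'a pt"

definition dsum :: "'a pt set \<Rightarrow> 'a pt set \<Rightarrow> 'a pt set" (infixr \<open>\<uplus>\<close> 65)
  where "N \<uplus> M = InL ` N \<union> InR ` M"

definition inclL :: "'a pt set \<Rightarrow> 'a pt \<Rightarrow> 'a pt"
  where "inclL N = (\<lambda>i\<in>N. InL i)"

definition inclR :: "'a pt set \<Rightarrow> 'a pt \<Rightarrow> 'a pt"
  where "inclR M = (\<lambda>i\<in>M. InR i)"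

text \<open>The copairing \<open>[\<phi>, \<psi>] : N \<uplus> M \<rightarrow> L\<close> of \<open>\<phi> : N \<rightarrow> L\<close> and \<open>\<psi> : M \<rightarrow> L\<close>.\<close>

definition copair ::
  "'a pt set \<Rightarrow> 'a pt set \<Rightarrow> ('a pt \<Rightarrow> 'a pt) \<Rightarrow> ('a pt \<Rightarrow> 'a pt) \<Rightarrow> 'a pt \<Rightarrow> 'a pt"
  where "copair N M \<phi> \<psi> =
    (\<lambda>p\<in>N \<uplus> M. case p of InL i \<Rightarrow> \<phi> i | InR j \<Rightarrow> \<psi> j | Atom a \<Rightarrow> undefined)"

definition dsum_map ::
  "'a pt set \<Rightarrow> 'a pt set \<Rightarrow> ('a pt \<Rightarrow> 'a pt) \<Rightarrow> ('a pt \<Rightarrow> 'a pt) \<Rightarrow> 'a pt \<Rightarrow> 'a pt"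
  where "dsum_map N M \<phi> \<psi> = copair N M (\<lambda>i. InL (\<phi> i)) (\<lambda>j. InR (\<psi> j))"

text \<open>The structure isomorphisms \<open>(N \<uplus> M) \<uplus> L \<rightarrow> N \<uplus> (M \<uplus> L)\<close>, \<open>\<emptyset> \<uplus> N \<rightarrow> N\<close>, \<open>N \<uplus> \<emptyset> \<rightarrow> N\<close>
  and \<open>N \<uplus> M \<rightarrow> M \<uplus> N\<close>.\<close>

definition associator :: "'a pt set \<Rightarrow> 'a pt set \<Rightarrow> 'a pt set \<Rightarrow> 'a pt \<Rightarrow> 'a pt"
  where "associator N M L =
    copair (N \<uplus> M) L (copair N M InL (\<lambda>j. InR (InL j))) (\<lambda>l. InR (InR l))"

definition left_unitor :: "'a pt set \<Rightarrow> 'a pt \<Rightarrow> 'a pt"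
  where "left_unitor N = copair {} N (\<lambda>_. undefined) (\<lambda>i. i)"

definition right_unitor :: "'a pt set \<Rightarrow> 'a pt \<Rightarrow> 'a pt"
  where "right_unitor N = copair N {} (\<lambda>i. i) (\<lambda>_. undefined)"

definition symmetry :: "'a pt set \<Rightarrow> 'a pt set \<Rightarrow> 'a pt \<Rightarrow> 'a pt"
  where "symmetry N M = copair N M InR InL"


section \<open>Lax symmetric monoidal functors from FinSet to Set\<close>

text \<open>
  The functor takes values in sets of elements of one type \<open>'x\<close>.  \<open>arr F N M \<phi>\<close> is the image of
  \<open>\<phi> : N \<rightarrow> M\<close> (domain and codomain are passed explicitly), \<open>lax F N M\<close> is the product comparison
  \<open>F N \<times> F M \<rightarrow> F (N \<uplus> M)\<close> and \<open>lax_unit F\<close> is the unit comparison \<open>{*} \<rightarrow> F \<emptyset>\<close>.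
  The coherence diagrams, being diagrams in Set, are stated on elements.
\<close>

record ('a, 'x) finset_functor =
  obj :: "'a pt set \<Rightarrow> 'x set"
  arr :: "'a pt set \<Rightarrow> 'a pt set \<Rightarrow> ('a pt \<Rightarrow> 'a pt) \<Rightarrow> 'x \<Rightarrow> 'x"
  lax :: "'a pt set \<Rightarrow> 'a pt set \<Rightarrow> 'x \<times> 'x \<Rightarrow> 'x"
  lax_unit :: "unit \<Rightarrow> 'x"

locale lax_symmetric_monoidal_functor =
  fixes F :: "('a, 'x) finset_functor"
  assumes arr_hom:
      "\<lbrakk>finite N; finite M; \<phi> \<in> N \<rightarrow>\<^sub>E M\<rbrakk> \<Longrightarrow> arr F N M \<phi> \<in> obj F N \<rightarrow>\<^sub>E obj F M"
    and arr_id: "finite N \<Longrightarrow> arr F N N (\<lambda>i\<in>N. i) = (\<lambda>x\<in>obj F N. x)"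
    and arr_comp:
      "\<lbrakk>finite N; finite M; finite L; \<phi> \<in> N \<rightarrow>\<^sub>E M; \<psi> \<in> M \<rightarrow>\<^sub>E L\<rbrakk> \<Longrightarrow>
        arr F N L (compose N \<psi> \<phi>) = compose (obj F N) (arr F M L \<psi>) (arr F N M \<phi>)"
    and lax_hom:
      "\<lbrakk>finite N; finite M\<rbrakk> \<Longrightarrow> lax F N M \<in> obj F N \<times> obj F M \<rightarrow>\<^sub>E obj F (N \<uplus> M)"
    and lax_unit_hom: "lax_unit F \<in> UNIV \<rightarrow>\<^sub>E obj F {}"
    and lax_natural:
      "\<lbrakk>finite N; finite N'; finite M; finite M'; \<phi> \<in> N \<rightarrow>\<^sub>E N'; \<psi> \<in> M \<rightarrow>\<^sub>E M';
        x \<in> obj F N; y \<in> obj F M\<rbrakk> \<Longrightarrow>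
        arr F (N \<uplus> M) (N' \<uplus> M') (dsum_map N M \<phi> \<psi>) (lax F N M (x, y)) =
        lax F N' M' (arr F N N' \<phi> x, arr F M M' \<psi> y)"
    and lax_assoc:
      "\<lbrakk>finite N; finite M; finite L; x \<in> obj F N; y \<in> obj F M; z \<in> obj F L\<rbrakk> \<Longrightarrow>
        arr F ((N \<uplus> M) \<uplus> L) (N \<uplus> (M \<uplus> L)) (associator N M L)
          (lax F (N \<uplus> M) L (lax F N M (x, y), z)) =
        lax F N (M \<uplus> L) (x, lax F M L (y, z))"
    and lax_left_unit:
      "\<lbrakk>finite N; x \<in> obj F N\<rbrakk> \<Longrightarrow>
        arr F ({} \<uplus> N) N (left_unitor N) (lax F {} N (lax_unit F (), x)) = x"
    and lax_right_unit:
      "\<lbrakk>finite N; x \<in> obj F N\<rbrakk> \<Longrightarrow>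
        arr F (N \<uplus> {}) N (right_unitor N) (lax F N {} (x, lax_unit F ())) = x"
    and lax_symmetric:
      "\<lbrakk>finite N; finite M; x \<in> obj F N; y \<in> obj F M\<rbrakk> \<Longrightarrow>
        arr F (N \<uplus> M) (M \<uplus> N) (symmetry N M) (lax F N M (x, y)) = lax F M N (y, x)"

locale monoidal_natural_transformation =
  F: lax_symmetric_monoidal_functor F + G: lax_symmetric_monoidal_functor G
  for F :: "('a, 'x) finset_functor" and G :: "('a, 'y) finset_functor" +
  fixes \<tau> :: "'a pt set \<Rightarrow> 'x \<Rightarrow> 'y"
  assumes component_hom: "finite N \<Longrightarrow> \<tau> N \<in> obj F N \<rightarrow>\<^sub>E obj G N"
    and natural:
      "\<lbrakk>finite N; finite M; \<phi> \<in> N \<rightarrow>\<^sub>E M\<rbrakk> \<Longrightarrow>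
        compose (obj F N) (\<tau> M) (arr F N M \<phi>) = compose (obj F N) (arr G N M \<phi>) (\<tau> N)"
    and monoidal:
      "\<lbrakk>finite N; finite M; x \<in> obj F N; y \<in> obj F M\<rbrakk> \<Longrightarrow>
        \<tau> (N \<uplus> M) (lax F N M (x, y)) = lax G N M (\<tau> N x, \<tau> M y)"
    and monoidal_unit: "\<tau> {} (lax_unit F ()) = lax_unit G ()"


section \<open>Differentiable functions on \<open>\<real>\<^sup>N\<close>\<close>

text \<open>
  Vectors in \<open>\<real>\<^sup>N\<close> are functions that are \<open>undefined\<close> outside \<open>N\<close>;
  \<open>\<real>\<^sup>N\<close> is the carrier of the library's product topology \<open>powertop_real N\<close>.
\<close>

type_synonym 'a vec = "'a pt \<Rightarrow> real"

definition RN :: "'a pt set \<Rightarrow> 'a vec set"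
  where "RN N = N \<rightarrow>\<^sub>E UNIV"

lemma RN_eq_topspace: "RN N = topspace (powertop_real N)"
  by (simp add: RN_def)

definition pullback :: "'a pt set \<Rightarrow> ('a pt \<Rightarrow> 'a pt) \<Rightarrow> 'a vec \<Rightarrow> 'a vec"
  where "pullback N \<phi> y = (\<lambda>i\<in>N. y (\<phi> i))"

definition pushforward ::
  "'a pt set \<Rightarrow> 'a pt set \<Rightarrow> ('a pt \<Rightarrow> 'a pt) \<Rightarrow> 'a vec \<Rightarrow> 'a vec"
  where "pushforward N M \<phi> x = (\<lambda>j\<in>M. \<Sum>i\<in>{i\<in>N. \<phi> i = j}. x i)"

definition partial_deriv :: "'a pt \<Rightarrow> ('a vec \<Rightarrow> real) \<Rightarrow> 'a vec \<Rightarrow> real"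
  where "partial_deriv i f x = deriv (\<lambda>t. f (x(i := t))) (x i)"

definition gradient :: "'a pt set \<Rightarrow> ('a vec \<Rightarrow> real) \<Rightarrow> 'a vec \<Rightarrow> 'a vec"
  where "gradient N f x = (\<lambda>i\<in>N. partial_deriv i f x)"

text \<open>\<open>C_nat n N f\<close>: all partial derivatives of \<open>f : \<real>\<^sup>N \<rightarrow> \<real>\<close> of order at most \<open>n\<close> exist and are
  continuous.\<close>

fun C_nat :: "nat \<Rightarrow> 'a pt set \<Rightarrow> ('a vec \<Rightarrow> real) \<Rightarrow> bool" where
  "C_nat 0 N f \<longleftrightarrow> continuous_map (powertop_real N) euclideanreal f"
| "C_nat (Suc n) N f \<longleftrightarrow>
    continuous_map (powertop_real N) euclideanreal f \<and>
    (\<forall>i\<in>N. (\<forall>x\<in>RN N. (\<lambda>t. f (x(i := t))) differentiable (at (x i))) \<and>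
           C_nat n N (partial_deriv i f))"

text \<open>Regularity of order \<open>k \<in> {0, 1, \<dots>, \<infinity>}\<close>; \<open>C_diff \<infinity>\<close> means smooth.\<close>

definition C_diff :: "enat \<Rightarrow> 'a pt set \<Rightarrow> ('a vec \<Rightarrow> real) \<Rightarrow> bool"
  where "C_diff k N f \<longleftrightarrow> (\<forall>n. enat n \<le> k \<longrightarrow> C_nat n N f)"

lemma C_diff_1:
  "C_diff 1 N f \<longleftrightarrow>
    continuous_map (powertop_real N) euclideanreal f \<and>
    (\<forall>i\<in>N. (\<forall>x\<in>RN N. (\<lambda>t. f (x(i := t))) differentiable (at (x i))) \<and>
           continuous_map (powertop_real N) euclideanreal (partial_deriv i f))"
proof -
  have "enat n \<le> 1 \<longleftrightarrow> n = 0 \<or> n = Suc 0" for n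
    by (metis One_nat_def enat_ord_simps(1) one_enat_def le_Suc_eq le_zero_eq)
  then have "C_diff 1 N f \<longleftrightarrow> (\<forall>n. n = 0 \<or> n = Suc 0 \<longrightarrow> C_nat n N f)"
    by (simp only: C_diff_def)
  also have "\<dots> \<longleftrightarrow> C_nat 0 N f \<and> C_nat (Suc 0) N f"
    by (simp only: all_conj_distrib imp_disjL simp_thms)
  finally show ?thesis
    by (simp only: C_nat.simps conj_left_absorb)
qed


section \<open>The functors Opt and Dynam and the gradient flow\<close>

text \<open>
  Both functors carry their order of differentiability as a parameter, because the negative
  gradient of a \<open>C\<^sup>1\<close> function is in general only continuous.  The flow goes from \<open>Opt (k + 1)\<close>
  to \<open>Dynam k\<close>: the case \<open>k = 0\<close> has all \<open>C\<^sup>1\<close> functions as source and continuous vector fields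
  as target, the case \<open>k = \<infinity>\<close> has smooth functions and smooth vector fields.
\<close>

definition Opt_obj :: "enat \<Rightarrow> 'a pt set \<Rightarrow> ('a vec \<Rightarrow> real) set"
  where "Opt_obj k N = {f \<in> RN N \<rightarrow>\<^sub>E UNIV. C_diff k N f}"

definition Opt :: "enat \<Rightarrow> ('a, 'a vec \<Rightarrow> real) finset_functor"
  where "Opt k = \<lparr>
    obj = Opt_obj k,
    arr = (\<lambda>N M \<phi>. \<lambda>f\<in>Opt_obj k N. \<lambda>y\<in>RN M. f (pullback N \<phi> y)),
    lax = (\<lambda>N M. \<lambda>(f, g)\<in>Opt_obj k N \<times> Opt_obj k M. \<lambda>z\<in>RN (N \<uplus> M).
             f (pullback N (inclL N) z) + g (pullback M (inclR M) z)),
    lax_unit = (\<lambda>_. \<lambda>x\<in>RN {}. 0)\<rparr>"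

definition Dynam_obj :: "enat \<Rightarrow> 'a pt set \<Rightarrow> ('a vec \<Rightarrow> 'a vec) set"
  where "Dynam_obj k N = {\<upsilon> \<in> RN N \<rightarrow>\<^sub>E RN N. \<forall>i\<in>N. C_diff k N (\<lambda>x. \<upsilon> x i)}"

lemma Dynam_obj_empty:
  "(\<upsilon> :: 'a vec \<Rightarrow> 'a vec) \<in> Dynam_obj k {} \<longleftrightarrow> \<upsilon> = (\<lambda>x\<in>RN {}. x)"
proof
  assume "\<upsilon> \<in> Dynam_obj k {}"
  then have \<upsilon>: "\<upsilon> \<in> RN {} \<rightarrow>\<^sub>E RN {}"
    by (simp add: Dynam_obj_def)
  moreover have "(\<lambda>x\<in>RN {}. x :: 'a vec) \<in> RN {} \<rightarrow>\<^sub>E RN {}"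
    by simp
  ultimately show "\<upsilon> = (\<lambda>x\<in>RN {}. x)"
  proof (rule PiE_ext)
    fix x :: "'a vec"
    assume x: "x \<in> RN {}"
    have "\<upsilon> x \<in> RN {}"
      using \<upsilon> x by (rule PiE_mem)
    with x show "\<upsilon> x = (\<lambda>x\<in>RN {}. x) x"
      by (simp add: RN_def)
  qed
qed (simp add: Dynam_obj_def)

definition Dynam :: "enat \<Rightarrow> ('a, 'a vec \<Rightarrow> 'a vec) finset_functor"
  where "Dynam k = \<lparr>
    obj = Dynam_obj k,
    arr = (\<lambda>N M \<phi>. \<lambda>\<upsilon>\<in>Dynam_obj k N. \<lambda>y\<in>RN M. pushforward N M \<phi> (\<upsilon> (pullback N \<phi> y))),
    lax = (\<lambda>N M. \<lambda>(\<upsilon>, \<rho>)\<in>Dynam_obj k N \<times> Dynam_obj k M. \<lambda>z\<in>RN (N \<uplus> M). \<lambda>j\<in>N \<uplus> M.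
             pushforward N (N \<uplus> M) (inclL N) (\<upsilon> (pullback N (inclL N) z)) j +
             pushforward M (N \<uplus> M) (inclR M) (\<rho> (pullback M (inclR M) z)) j),
    lax_unit = (\<lambda>_. \<lambda>x\<in>RN {}. x)\<rparr>"

text \<open>\<open>flow k\<close> is defined on the \<open>C\<^sup>k\<close> functions.\<close>

definition flow :: "enat \<Rightarrow> 'a pt set \<Rightarrow> ('a vec \<Rightarrow> real) \<Rightarrow> 'a vec \<Rightarrow> 'a vec"
  where "flow k N = (\<lambda>f\<in>Opt_obj k N. \<lambda>x\<in>RN N. \<lambda>i\<in>N. - gradient N f x i)"

end

theory Submission
  imports Defs
begin

text \<open>
  The negative gradient is natural because of the chain rule for a pullback
  \<open>\<phi>\<^sup>* : \<real>\<^sup>M \<rightarrow> \<real>\<^sup>N\<close>.  Moving the coordinate \<open>j \<in> M\<close> of \<open>y\<close> moves all coordinates of \<open>\<phi>\<^sup>* y\<close>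
  in the fibre of \<open>j\<close> at once and at unit speed, so
  \<open>\<partial>\<^sub>j (f \<circ> \<phi>\<^sup>*) (y)\<close> is the sum of \<open>\<partial>\<^sub>i f (\<phi>\<^sup>* y)\<close> over all \<open>i\<close> with \<open>\<phi> i = j\<close>,
  which is \<open>\<nabla>(f \<circ> \<phi>\<^sup>*) = \<phi>\<^sub>* \<circ> \<nabla>f \<circ> \<phi>\<^sup>*\<close> (\<open>DERIV_pullback\<close>, \<open>flow_arr\<close>).
  The chain rule needs more than the existence of the partial derivatives: \<open>f\<close> is differentiable in
  the direction of several coordinates because the partial derivatives are also continuous
  (\<open>DERIV_diagonal\<close>).

  Compatibility with the product comparisons is the same formula for the two inclusions, whose
  fibres have at most one element: a partial derivative of \<open>f \<circ> \<iota>\<^sub>N\<^sup>* + g \<circ> \<iota>\<^sub>M\<^sup>*\<close> sees only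
  the summand that contains its coordinate (\<open>flow_lax\<close>).  The unit law holds because there is only
  one vector field on \<open>\<real>\<^sup>\<emptyset>\<close>.

  That \<open>Opt\<close> and \<open>Dynam\<close> preserve the class \<open>C\<^sup>k\<close> comes from applying the chain rule to all
  iterated partial derivatives (\<open>C_nat_pullback\<close>).  Their coherence laws reduce to
  laws of vectors: a product comparison of vector fields places two vectors side by side
  (\<open>join\<close>), every structure isomorphism of the disjoint union is a copairing, and the pushforward
  along a copairing is the sum of the two pushforwards (\<open>pushforward_copair\<close>).
\<close>


section \<open>Vectors and pullbacks\<close>

lemma pullback_in_RN [simp]: "pullback N \<phi> y \<in> RN N"
  by (simp add: pullback_def RN_def)

lemma RN_eqI:
  assumes "x \<in> RN N" and "y \<in> RN N" and "\<And>i. i \<in> N \<Longrightarrow> x i = y i"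
  shows "x = y"
  using assms unfolding RN_def by (rule PiE_ext)

lemma fun_upd_in_RN: "x \<in> RN N \<Longrightarrow> i \<in> N \<Longrightarrow> x(i := t) \<in> RN N"
  by (auto simp: RN_def PiE_def extensional_def)

lemma pullback_id: "y \<in> RN N \<Longrightarrow> pullback N (\<lambda>i\<in>N. i) y = y"
  by (auto simp: RN_def pullback_def PiE_def extensional_def)

lemma pullback_compose:
  assumes "\<phi> \<in> N \<rightarrow> M"
  shows "pullback N (compose N \<psi> \<phi>) y = pullback N \<phi> (pullback M \<psi> y)"
  using assms by (auto simp: pullback_def compose_def fun_eq_iff)

lemma continuous_map_pullback:
  assumes "\<phi> \<in> N \<rightarrow> M"
  shows "continuous_map (powertop_real M) (powertop_real N) (pullback N \<phi>)"
proof -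
  have "continuous_map (powertop_real M) euclideanreal (\<lambda>y. pullback N \<phi> y i)" if "i \<in> N" for i
  proof -
    have "\<phi> i \<in> M"
      using assms that by auto
    then show ?thesis
      using that continuous_map_product_projection[of "\<phi> i" M "\<lambda>_. euclideanreal"]
      by (simp add: pullback_def)
  qed
  then show ?thesis
    by (auto simp: continuous_map_componentwise pullback_def)
qed


section \<open>Functions of class \<open>C\<^sup>n\<close>\<close>

lemma partial_deriv_cong:
  assumes "\<And>x. x \<in> RN N \<Longrightarrow> f x = g x" and "i \<in> N" and "x \<in> RN N"
  shows "partial_deriv i f x = partial_deriv i g x"
proof -
  have "(\<lambda>t. f (x(i := t))) = (\<lambda>t. g (x(i := t)))"
    using assms fun_upd_in_RN by blast
  then show ?thesis
    by (simp add: partial_deriv_def)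
qed

lemma C_nat_imp_continuous: "C_nat n N f \<Longrightarrow> continuous_map (powertop_real N) euclideanreal f"
  by (cases n) auto

text \<open>
  A function on \<open>\<real>\<^sup>N\<close> is a HOL function with irrelevant values outside \<open>RN N\<close>, while
  \<open>partial_deriv\<close> is defined for arbitrary HOL functions.  This congruence makes it harmless that
  the members of \<open>Opt_obj\<close> are restrictions to \<open>RN N\<close>.
\<close>

lemma C_nat_cong:
  assumes "\<And>x. x \<in> RN N \<Longrightarrow> f x = g x"
  shows "C_nat n N f \<longleftrightarrow> C_nat n N g"
  using assms
proof (induction n arbitrary: f g)
  case 0
  then show ?case
    by (auto simp: RN_eq_topspace intro: continuous_map_eq)
next
  case (Suc n)
  have "continuous_map (powertop_real N) euclideanreal f \<longleftrightarrow>
      continuous_map (powertop_real N) euclideanreal g"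
    using Suc.prems by (auto simp: RN_eq_topspace intro: continuous_map_eq)
  moreover have "(\<lambda>t. f (x(i := t))) = (\<lambda>t. g (x(i := t)))" if "i \<in> N" "x \<in> RN N" for i x
    using that Suc.prems fun_upd_in_RN by blast
  moreover have "C_nat n N (partial_deriv i f) \<longleftrightarrow> C_nat n N (partial_deriv i g)" if "i \<in> N" for i
    by (rule Suc.IH) (rule partial_deriv_cong[OF Suc.prems that])
  ultimately show ?case
    by simp
qed

lemma partial_deriv_works:
  assumes "C_nat (Suc n) N f" and "i \<in> N" and "x \<in> RN N"
  shows "((\<lambda>t. f (x(i := t))) has_field_derivative partial_deriv i f x) (at (x i))"
  using assms by (simp add: partial_deriv_def DERIV_deriv_iff_real_differentiable)

text \<open>
  Derivative rules supply a candidate \<open>f' i\<close> for each partial derivative; by uniqueness of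
  derivatives it suffices that the candidates are of class \<open>C\<^sup>n\<close>.
\<close>

lemma C_nat_Suc_I:
  assumes "continuous_map (powertop_real N) euclideanreal f"
    and "\<And>i x. i \<in> N \<Longrightarrow> x \<in> RN N \<Longrightarrow>
      ((\<lambda>t. f (x(i := t))) has_field_derivative f' i x) (at (x i))"
    and "\<And>i. i \<in> N \<Longrightarrow> C_nat n N (f' i)"
  shows "C_nat (Suc n) N f"
proof -
  have "C_nat n N (partial_deriv i f)" if "i \<in> N" for i
  proof -
    have "partial_deriv i f x = f' i x" if "x \<in> RN N" for x
      unfolding partial_deriv_def by (rule DERIV_imp_deriv) (rule assms(2)[OF \<open>i \<in> N\<close> that])
    then show ?thesis
      using assms(3)[OF that] C_nat_cong by blast
  qed
  with assms show ?thesis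
    by (auto simp: real_differentiable_def)
qed

lemma C_nat_const [simp]: "C_nat n N (\<lambda>_. c)"
proof (induction n arbitrary: c)
  case (Suc n)
  show ?case
    by (rule C_nat_Suc_I[where f' = "\<lambda>_ _. 0"]) (auto intro: Suc)
qed simp

lemma C_nat_add:
  assumes "C_nat n N f" and "C_nat n N g"
  shows "C_nat n N (\<lambda>x. f x + g x)"
  using assms
proof (induction n arbitrary: f g)
  case (Suc n)
  show ?case
  proof (rule C_nat_Suc_I[where f' = "\<lambda>i x. partial_deriv i f x + partial_deriv i g x"])
    show "continuous_map (powertop_real N) euclideanreal (\<lambda>x. f x + g x)"
      using Suc.prems by (intro continuous_map_add) auto
  qed (use Suc in \<open>auto intro!: DERIV_add partial_deriv_works[where n = n] simp del: fun_upd_apply\<close>)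
qed (simp add: continuous_map_add)

lemma C_nat_minus:
  assumes "C_nat n N f"
  shows "C_nat n N (\<lambda>x. - f x)"
  using assms
proof (induction n arbitrary: f)
  case (Suc n)
  show ?case
  proof (rule C_nat_Suc_I[where f' = "\<lambda>i x. - partial_deriv i f x"])
    show "continuous_map (powertop_real N) euclideanreal (\<lambda>x. - f x)"
      using Suc.prems by (intro continuous_map_minus) auto
  qed (use Suc in \<open>auto intro!: DERIV_minus partial_deriv_works[where n = n] simp del: fun_upd_apply\<close>)
qed (simp add: continuous_map_minus)

lemma C_nat_sum:
  assumes "finite S" and "\<And>i. i \<in> S \<Longrightarrow> C_nat n N (f i)"
  shows "C_nat n N (\<lambda>x. \<Sum>i\<in>S. f i x)"
  using assms by (induction S) (auto intro: C_nat_add)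


section \<open>The chain rule for pullbacks\<close>

text \<open>
  The heart of the chain rule, by induction on \<open>S\<close>.  To add a coordinate \<open>a\<close>, move the coordinates
  in \<open>S\<close> by \<open>t\<close> and the coordinate \<open>a\<close> independently by \<open>s\<close>.  The resulting function of two real
  variables has a derivative in \<open>t\<close> by the induction hypothesis and a continuous derivative in
  \<open>s\<close>; so it is differentiable at the origin, and one restricts it to the diagonal \<open>s = t\<close>.
\<close>

lemma DERIV_diagonal:
  assumes f: "C_nat (Suc n) N f" and "finite S" and "S \<subseteq> N" and x: "x \<in> RN N"
  shows "((\<lambda>t. f (\<lambda>i. if i \<in> S then x i + t else x i)) has_field_derivative
    (\<Sum>i\<in>S. partial_deriv i f x)) (at 0)"
  using assms(2,3)
proof (induction S)
  case empty
  then show ?case by simp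
next
  case (insert a S)
  then have a: "a \<in> N" "a \<notin> S"
    by auto
  define w where "w t s = (\<lambda>i. if i \<in> S then x i + t else if i = a then x i + s else x i)" for t s
  have w: "w t s \<in> RN N" for t s
    using x insert.prems by (auto simp: w_def RN_def PiE_def extensional_def)
  have w_upd: "w t s' = (w t s)(a := x a + s')" for t s s'
    using a by (auto simp: w_def)
  have "continuous_map euclidean (powertop_real N) (\<lambda>p. w (fst p) (snd p))"
  proof -
    have "continuous_on UNIV (\<lambda>p. w (fst p) (snd p) i)" for i
      unfolding w_def by (cases "i \<in> S"; cases "i = a") (auto intro!: continuous_intros)
    then show ?thesis
      using w by (auto simp: continuous_map_componentwise RN_def PiE_def Pi_def)
  qed
  moreover have "continuous_map (powertop_real N) euclideanreal (partial_deriv a f)"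
    using f a C_nat_imp_continuous by auto
  ultimately have cont: "continuous_on UNIV (\<lambda>p. partial_deriv a f (w (fst p) (snd p)))"
    using continuous_map_compose by (fastforce simp: o_def)
  \<comment> \<open>Differentiability in two variables: one partial derivative at the origin and the other one
    continuous are enough.\<close>
  have "((\<lambda>(t, s). f (w t s)) has_derivative
      (\<lambda>(t, s). t * (\<Sum>i\<in>S. partial_deriv i f x)
        + blinfun_apply (blinfun_scaleR_left (partial_deriv a f (w 0 0))) s))
      (at (0, 0) within UNIV \<times> UNIV)"
  proof (rule has_derivative_partialsI
      [where fy = "\<lambda>t s. blinfun_scaleR_left (partial_deriv a f (w t s))"])
    have "w t 0 = (\<lambda>i. if i \<in> S then x i + t else x i)" for t
      by (auto simp: w_def)
    then show "((\<lambda>t. f (w t 0)) has_derivative (\<lambda>t. t * (\<Sum>i\<in>S. partial_deriv i f x))) (at 0)"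
      using insert.IH insert.prems by (simp add: has_field_derivative_def mult_commute_abs)
  next
    fix t s :: real
    have "((\<lambda>u. f ((w t s)(a := u))) has_field_derivative partial_deriv a f (w t s)) (at (x a + s))"
      using partial_deriv_works[OF f a(1) w, of t s] a by (simp add: w_def)
    then have "((\<lambda>s'. f ((w t s)(a := x a + s'))) has_field_derivative partial_deriv a f (w t s))
        (at s)"
      using DERIV_shift[of "\<lambda>u. f ((w t s)(a := u))" "partial_deriv a f (w t s)" s "x a"]
      by (simp add: add.commute)
    then show "((\<lambda>s'. f (w t s')) has_derivative
        blinfun_apply (blinfun_scaleR_left (partial_deriv a f (w t s)))) (at s)"
      by (subst w_upd[of t _ s]) (simp add: has_field_derivative_def mult_commute_abs)
  next
    show "continuous (at (0, 0) within UNIV \<times> UNIV)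
        (\<lambda>(t, s). blinfun_scaleR_left (partial_deriv a f (w t s)))"
      using cont unfolding split_beta UNIV_Times_UNIV
      by (intro bounded_linear.continuous[OF bounded_linear_blinfun_scaleR_left])
        (simp add: continuous_on_eq_continuous_at)
  qed auto
  \<comment> \<open>The restriction to the diagonal.\<close>
  then have "((\<lambda>t. (\<lambda>(t, s). f (w t s)) (t, t)) has_derivative
      (\<lambda>t. (\<lambda>(t, s). t * (\<Sum>i\<in>S. partial_deriv i f x) + s * partial_deriv a f (w 0 0)) (t, t)))
      (at 0)"
    by (intro has_derivative_compose[where g = "\<lambda>(t, s). f (w t s)" and f = "\<lambda>t. (t, t)"])
      (auto intro!: derivative_eq_intros)
  moreover have "w 0 0 = x"
    by (auto simp: w_def)
  moreover have "w t t = (\<lambda>i. if i \<in> insert a S then x i + t else x i)" for t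
    by (auto simp: w_def)
  ultimately have "((\<lambda>t. f (\<lambda>i. if i \<in> insert a S then x i + t else x i)) has_derivative
      (\<lambda>t. t * (\<Sum>i\<in>S. partial_deriv i f x) + t * partial_deriv a f x)) (at 0)"
    by simp
  then show ?case
    by (rule has_derivative_imp_has_field_derivative)
      (use a insert.hyps in \<open>simp add: distrib_left add.commute\<close>)
qed

text \<open>
  The previous lemma for the fibre of \<open>j\<close>, after moving the base point of the parameter from \<open>0\<close> to
  \<open>y j\<close>.
\<close>

lemma DERIV_pullback:
  assumes f: "C_nat (Suc n) N f" and "finite N"
  shows "((\<lambda>t. f (pullback N \<phi> (y(j := t)))) has_field_derivative
    (\<Sum>i\<in>{i\<in>N. \<phi> i = j}. partial_deriv i f (pullback N \<phi> y))) (at (y j))"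
proof -
  let ?S = "{i \<in> N. \<phi> i = j}"
  have "((\<lambda>t. f (\<lambda>i. if i \<in> ?S then pullback N \<phi> y i + t else pullback N \<phi> y i)) has_field_derivative
    (\<Sum>i\<in>?S. partial_deriv i f (pullback N \<phi> y))) (at (y j + - y j))"
    using DERIV_diagonal[OF f, of ?S "pullback N \<phi> y"] \<open>finite N\<close> by simp
  then have "((\<lambda>t. f (\<lambda>i. if i \<in> ?S then pullback N \<phi> y i + (t + - y j) else pullback N \<phi> y i))
      has_field_derivative (\<Sum>i\<in>?S. partial_deriv i f (pullback N \<phi> y))) (at (y j))"
    by (simp only: DERIV_shift)
  moreover have "(\<lambda>i. if i \<in> ?S then pullback N \<phi> y i + (t + - y j) else pullback N \<phi> y i) =
      pullback N \<phi> (y(j := t))" for t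
    by (auto simp: pullback_def)
  ultimately show ?thesis
    by simp
qed

lemma partial_deriv_pullback:
  assumes "C_nat (Suc n) N f" and "finite N"
  shows "partial_deriv j (\<lambda>y. f (pullback N \<phi> y)) y =
    (\<Sum>i\<in>{i\<in>N. \<phi> i = j}. partial_deriv i f (pullback N \<phi> y))"
  unfolding partial_deriv_def[of j] using DERIV_pullback[OF assms] by (rule DERIV_imp_deriv)

text \<open>
  By the chain rule, the partial derivatives of \<open>f \<circ> \<phi>\<^sup>*\<close> are finite sums of pullbacks of partial
  derivatives of \<open>f\<close>, which have one order of differentiability less; this closes the induction.
\<close>

lemma C_nat_pullback:
  assumes "C_nat n N f" and "finite N" and \<phi>: "\<phi> \<in> N \<rightarrow> M"
  shows "C_nat n M (\<lambda>y. f (pullback N \<phi> y))"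
  using assms(1)
proof (induction n arbitrary: f)
  case 0
  then show ?case
    using continuous_map_compose[OF continuous_map_pullback[OF \<phi>]] by (auto simp: o_def)
next
  case (Suc n)
  show ?case
  proof (rule C_nat_Suc_I)
    show "continuous_map (powertop_real M) euclideanreal (\<lambda>y. f (pullback N \<phi> y))"
      using Suc.prems continuous_map_compose[OF continuous_map_pullback[OF \<phi>]] by (auto simp: o_def)
    show "((\<lambda>t. f (pullback N \<phi> (y(j := t)))) has_field_derivative
      (\<Sum>i\<in>{i\<in>N. \<phi> i = j}. partial_deriv i f (pullback N \<phi> y))) (at (y j))" for y j
      by (rule DERIV_pullback[OF Suc.prems \<open>finite N\<close>])
    show "C_nat n M (\<lambda>y. \<Sum>i\<in>{i\<in>N. \<phi> i = j}. partial_deriv i f (pullback N \<phi> y))" for j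
      using Suc \<open>finite N\<close> by (intro C_nat_sum) auto
  qed
qed


section \<open>Disjoint unions\<close>

lemma finite_dsum [simp]: "finite N \<Longrightarrow> finite M \<Longrightarrow> finite (N \<uplus> M)"
  by (simp add: dsum_def)

lemma InL_in_dsum [simp]: "InL i \<in> N \<uplus> M \<longleftrightarrow> i \<in> N"
  and InR_in_dsum [simp]: "InR j \<in> N \<uplus> M \<longleftrightarrow> j \<in> M"
  by (auto simp: dsum_def)

lemma dsum_cases [consumes 1, case_names InL InR]:
  assumes "p \<in> N \<uplus> M"
  obtains i where "p = InL i" "i \<in> N" | j where "p = InR j" "j \<in> M"
  using assms by (auto simp: dsum_def)

lemma inclL_apply [simp]: "i \<in> N \<Longrightarrow> inclL N i = InL i"
  and inclR_apply [simp]: "j \<in> M \<Longrightarrow> inclR M j = InR j"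
  by (simp_all add: inclL_def inclR_def)

lemma copair_InL [simp]: "i \<in> N \<Longrightarrow> copair N M \<phi> \<psi> (InL i) = \<phi> i"
  and copair_InR [simp]: "j \<in> M \<Longrightarrow> copair N M \<phi> \<psi> (InR j) = \<psi> j"
  by (simp_all add: copair_def)

lemma copair_in:
  assumes "\<And>i. i \<in> N \<Longrightarrow> \<phi> i \<in> L" and "\<And>j. j \<in> M \<Longrightarrow> \<psi> j \<in> L"
  shows "copair N M \<phi> \<psi> \<in> N \<uplus> M \<rightarrow>\<^sub>E L"
  using assms by (auto simp: copair_def elim!: dsum_cases)

lemma dsum_map_in:
  assumes "\<phi> \<in> N \<rightarrow>\<^sub>E N'" and "\<psi> \<in> M \<rightarrow>\<^sub>E M'"
  shows "dsum_map N M \<phi> \<psi> \<in> N \<uplus> M \<rightarrow>\<^sub>E N' \<uplus> M'"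
  unfolding dsum_map_def using assms by (intro copair_in) auto

lemma associator_in: "associator N M L \<in> (N \<uplus> M) \<uplus> L \<rightarrow>\<^sub>E N \<uplus> (M \<uplus> L)"
  unfolding associator_def by (intro copair_in) (auto elim!: dsum_cases)

lemma left_unitor_in: "left_unitor N \<in> {} \<uplus> N \<rightarrow>\<^sub>E N"
  unfolding left_unitor_def by (intro copair_in) auto

lemma right_unitor_in: "right_unitor N \<in> N \<uplus> {} \<rightarrow>\<^sub>E N"
  unfolding right_unitor_def by (intro copair_in) auto

lemma symmetry_in: "symmetry N M \<in> N \<uplus> M \<rightarrow>\<^sub>E M \<uplus> N"
  unfolding symmetry_def by (intro copair_in) auto


section \<open>Pullback and pushforward along the structure maps\<close>

lemma pullback_cong:
  "\<lbrakk>\<And>i. i \<in> N \<Longrightarrow> \<phi> i = \<psi> i; y = z\<rbrakk> \<Longrightarrow> pullback N \<phi> y = pullback N \<psi> z"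
  by (auto simp: pullback_def)

text \<open>
  The product comparisons restrict vectors to the two summands.  The following laws say what
  these restrictions are after a pullback along each of the structure maps.
\<close>

lemma pullback_dsum_map:
  assumes "\<phi> \<in> N \<rightarrow>\<^sub>E N'" and "\<psi> \<in> M \<rightarrow>\<^sub>E M'"
  shows "pullback N InL (pullback (N \<uplus> M) (dsum_map N M \<phi> \<psi>) y) =
      pullback N \<phi> (pullback N' InL y)"
    and "pullback M InR (pullback (N \<uplus> M) (dsum_map N M \<phi> \<psi>) y) =
      pullback M \<psi> (pullback M' InR y)"
  using assms[THEN PiE_mem] by (auto simp: pullback_def dsum_map_def intro!: restrict_ext)

lemma pullback_associator:
  shows "pullback N InL (pullback (N \<uplus> M) InL
      (pullback ((N \<uplus> M) \<uplus> L) (associator N M L) y)) = pullback N InL y"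
    and "pullback M InR (pullback (N \<uplus> M) InL
      (pullback ((N \<uplus> M) \<uplus> L) (associator N M L) y)) = pullback M InL (pullback (M \<uplus> L) InR y)"
    and "pullback L InR (pullback ((N \<uplus> M) \<uplus> L) (associator N M L) y) =
      pullback L InR (pullback (M \<uplus> L) InR y)"
  by (auto simp: pullback_def associator_def)

lemma pullback_left_unitor:
  "y \<in> RN N \<Longrightarrow> pullback N InR (pullback ({} \<uplus> N) (left_unitor N) y) = y"
  by (rule RN_eqI[of _ N])
    (simp_all add: pullback_def[of N InR] pullback_def[of "{} \<uplus> N"]
      left_unitor_def RN_def)

lemma pullback_right_unitor:
  "y \<in> RN N \<Longrightarrow> pullback N InL (pullback (N \<uplus> {}) (right_unitor N) y) = y"
  by (rule RN_eqI[of _ N])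
    (simp_all add: pullback_def[of N InL] pullback_def[of "N \<uplus> {}"]
      right_unitor_def RN_def)

lemma pullback_symmetry:
  "pullback N InL (pullback (N \<uplus> M) (symmetry N M) y) = pullback N InR y"
  "pullback M InR (pullback (N \<uplus> M) (symmetry N M) y) = pullback M InL y"
  by (auto simp: pullback_def symmetry_def)

text \<open>
  A fibre of a copairing is the disjoint union of the fibres of the two maps.
\<close>

lemma sum_fibre_copair:
  assumes "finite N" and "finite M"
  shows "(\<Sum>p\<in>{p \<in> N \<uplus> M. copair N M \<phi> \<psi> p = l}. w p) =
    (\<Sum>i\<in>{i\<in>N. \<phi> i = l}. w (InL i)) + (\<Sum>j\<in>{j\<in>M. \<psi> j = l}. w (InR j))"
proof -
  have "{p \<in> N \<uplus> M. copair N M \<phi> \<psi> p = l} =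
      InL ` {i\<in>N. \<phi> i = l} \<union> InR ` {j\<in>M. \<psi> j = l}"
    by (auto elim!: dsum_cases)
  moreover have "InL ` {i\<in>N. \<phi> i = l} \<inter> InR ` {j\<in>M. \<psi> j = l} = {}"
    by auto
  ultimately show ?thesis
    using assms by (simp add: sum.union_disjoint sum.reindex inj_on_def)
qed

text \<open>
  The isomorphism \<open>\<real>\<^sup>N \<times> \<real>\<^sup>M \<rightarrow> \<real>\<^sup>N\<^sup>+\<^sup>M\<close>, that is, \<open>\<iota>\<^sub>N\<^sub>* u + \<iota>\<^sub>M\<^sub>* v\<close> (see
  \<open>pushforward_inclusions\<close>).  Unlike the sum of the two pushforwards, it is evaluated at a tagged
  point without a sum over a fibre.
\<close>

definition join :: "'a pt set \<Rightarrow> 'a pt set \<Rightarrow> 'a vec \<Rightarrow> 'a vec \<Rightarrow> 'a vec"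
  where "join N M u v =
    (\<lambda>p\<in>N \<uplus> M. case p of InL i \<Rightarrow> u i | InR j \<Rightarrow> v j | Atom a \<Rightarrow> undefined)"

lemma join_InL [simp]: "i \<in> N \<Longrightarrow> join N M u v (InL i) = u i"
  and join_InR [simp]: "j \<in> M \<Longrightarrow> join N M u v (InR j) = v j"
  by (simp_all add: join_def)

lemma join_in_RN [simp]: "join N M u v \<in> RN (N \<uplus> M)"
  by (simp add: join_def RN_def)

lemma pushforward_in_RN [simp]: "pushforward N M \<phi> x \<in> RN M"
  by (simp add: pushforward_def RN_def)

lemma fibre_self [simp]: "i \<in> N \<Longrightarrow> {i' \<in> N. i' = i} = {i}"
  by auto

lemma pushforward_id:
  assumes "x \<in> RN N"
  shows "pushforward N N (\<lambda>i\<in>N. i) x = x"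
proof (rule RN_eqI[OF pushforward_in_RN assms])
  fix i assume "i \<in> N"
  moreover from this have "{i' \<in> N. (if i' \<in> N then i' else undefined) = i} = {i}"
    by auto
  ultimately show "pushforward N N (\<lambda>i\<in>N. i) x i = x i"
    by (simp add: pushforward_def restrict_def)
qed

text \<open>
  The fibre of a composite is partitioned by the fibres of the first map.
\<close>

lemma pushforward_compose:
  assumes "finite N" and "finite M" and "\<phi> \<in> N \<rightarrow> M"
  shows "pushforward N L (compose N \<psi> \<phi>) x = pushforward M L \<psi> (pushforward N M \<phi> x)"
proof (rule RN_eqI[of _ L])
  fix l assume l: "l \<in> L"
  let ?S = "{i \<in> N. \<psi> (\<phi> i) = l}" and ?T = "{j \<in> M. \<psi> j = l}"
  have "pushforward M L \<psi> (pushforward N M \<phi> x) l = (\<Sum>j\<in>?T. \<Sum>i\<in>{i \<in> ?S. \<phi> i = j}. x i)"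
    using l by (auto simp: pushforward_def intro!: sum.cong)
  also have "\<dots> = (\<Sum>i\<in>?S. x i)"
    using assms by (intro sum.group) auto
  also have "\<dots> = pushforward N L (compose N \<psi> \<phi>) x l"
    using l by (auto simp: pushforward_def compose_def intro!: sum.cong)
  finally show "pushforward N L (compose N \<psi> \<phi>) x l =
      pushforward M L \<psi> (pushforward N M \<phi> x) l" ..
qed simp_all

lemma pushforward_copair:
  assumes "finite N" and "finite M" and "l \<in> L"
  shows "pushforward (N \<uplus> M) L (copair N M \<phi> \<psi>) (join N M u v) l =
    (\<Sum>i\<in>{i\<in>N. \<phi> i = l}. u i) + (\<Sum>j\<in>{j\<in>M. \<psi> j = l}. v j)"
  using assms by (simp add: pushforward_def sum_fibre_copair)

lemma pushforward_dsum_map: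
  assumes "finite N" and "finite M"
  shows "pushforward (N \<uplus> M) (N' \<uplus> M') (dsum_map N M \<phi> \<psi>) (join N M u v) =
    join N' M' (pushforward N N' \<phi> u) (pushforward M M' \<psi> v)"
proof (rule RN_eqI)
  fix l assume l: "l \<in> N' \<uplus> M'"
  then show "pushforward (N \<uplus> M) (N' \<uplus> M') (dsum_map N M \<phi> \<psi>) (join N M u v) l =
    join N' M' (pushforward N N' \<phi> u) (pushforward M M' \<psi> v) l"
    unfolding dsum_map_def pushforward_copair[OF assms l]
    by (cases rule: dsum_cases) (simp_all add: pushforward_def)
qed simp_all

text \<open>
  The associator is a copairing with a copairing inside, so the sum over its fibre splits twice;
  of the three resulting sums, exactly one has a nonempty index set.
\<close>

lemma pushforward_associator:
  assumes "finite N" and "finite M" and "finite L"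
  shows "pushforward ((N \<uplus> M) \<uplus> L) (N \<uplus> (M \<uplus> L)) (associator N M L)
    (join (N \<uplus> M) L (join N M u v) w) = join N (M \<uplus> L) u (join M L v w)"
proof (rule RN_eqI)
  fix l assume l: "l \<in> N \<uplus> (M \<uplus> L)"
  have *: "pushforward ((N \<uplus> M) \<uplus> L) (N \<uplus> (M \<uplus> L)) (associator N M L)
      (join (N \<uplus> M) L (join N M u v) w) l =
    (\<Sum>i\<in>{i\<in>N. InL i = l}. u i) + (\<Sum>j\<in>{j\<in>M. InR (InL j) = l}. v j) +
    (\<Sum>k\<in>{k\<in>L. InR (InR k) = l}. w k)"
    unfolding associator_def using assms l
    by (simp only: pushforward_copair sum_fibre_copair finite_dsum)
      (intro arg_cong2[where f = "(+)"] sum.cong; force)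
  from l show "pushforward ((N \<uplus> M) \<uplus> L) (N \<uplus> (M \<uplus> L)) (associator N M L)
      (join (N \<uplus> M) L (join N M u v) w) l = join N (M \<uplus> L) u (join M L v w) l"
    unfolding * by (auto elim!: dsum_cases)
qed simp_all

lemma pushforward_left_unitor:
  assumes "finite N" and "v \<in> RN N"
  shows "pushforward ({} \<uplus> N) N (left_unitor N) (join {} N u v) = v"
  by (rule RN_eqI[of _ N]) (use assms in \<open>simp_all add: left_unitor_def pushforward_copair\<close>)

lemma pushforward_right_unitor:
  assumes "finite N" and "u \<in> RN N"
  shows "pushforward (N \<uplus> {}) N (right_unitor N) (join N {} u v) = u"
  by (rule RN_eqI[of _ N]) (use assms in \<open>simp_all add: right_unitor_def pushforward_copair\<close>)

lemma pushforward_symmetry: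
  assumes "finite N" and "finite M"
  shows "pushforward (N \<uplus> M) (M \<uplus> N) (symmetry N M) (join N M u v) = join M N v u"
  by (rule RN_eqI[of _ "M \<uplus> N"])
    (use assms in \<open>auto simp: symmetry_def pushforward_copair elim!: dsum_cases\<close>)


section \<open>The functor Opt\<close>

lemma C_diff_cong: "(\<And>x. x \<in> RN N \<Longrightarrow> f x = g x) \<Longrightarrow> C_diff k N f \<longleftrightarrow> C_diff k N g"
  unfolding C_diff_def using C_nat_cong by blast

lemma C_diff_pullback:
  "\<lbrakk>C_diff k N f; finite N; \<phi> \<in> N \<rightarrow> M\<rbrakk> \<Longrightarrow> C_diff k M (\<lambda>y. f (pullback N \<phi> y))"
  unfolding C_diff_def using C_nat_pullback by blast

text \<open>
  For \<open>k = \<infinity>\<close> one has \<open>k + 1 = k\<close>, so this also says that partial derivatives of smooth functions are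
  smooth.
\<close>

lemma C_diff_partial_deriv:
  assumes "C_diff (k + 1) N f" and "i \<in> N"
  shows "C_diff k N (partial_deriv i f)"
  unfolding C_diff_def
proof (intro allI impI)
  fix n assume "enat n \<le> k"
  then have "enat (Suc n) \<le> k + 1"
    by (simp flip: eSuc_enat add: plus_1_eSuc)
  with assms have "C_nat (Suc n) N f"
    by (simp only: C_diff_def)
  with \<open>i \<in> N\<close> show "C_nat n N (partial_deriv i f)"
    by simp
qed

lemma C_diff_imp_C_1: "C_diff (k + 1) N f \<Longrightarrow> C_nat (Suc 0) N f"
  unfolding C_diff_def by (auto simp: one_enat_def simp del: C_nat.simps)

lemma obj_Opt [simp]: "obj (Opt k) = Opt_obj k"
  by (simp add: Opt_def)

lemma arr_Opt:
  "f \<in> Opt_obj k N \<Longrightarrow> arr (Opt k) N M \<phi> f = (\<lambda>y\<in>RN M. f (pullback N \<phi> y))"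
  by (simp add: Opt_def)

lemma lax_Opt:
  "f \<in> Opt_obj k N \<Longrightarrow> g \<in> Opt_obj k M \<Longrightarrow> lax (Opt k) N M (f, g) =
    (\<lambda>z\<in>RN (N \<uplus> M). f (pullback N (inclL N) z) + g (pullback M (inclR M) z))"
  by (simp add: Opt_def)

lemma lax_unit_Opt: "lax_unit (Opt k) () = (\<lambda>x\<in>RN {}. 0)"
  by (simp add: Opt_def)

lemma Opt_objI: "C_diff k N f \<Longrightarrow> (\<lambda>x\<in>RN N. f x) \<in> Opt_obj k N"
  by (auto simp: Opt_obj_def cong: C_diff_cong)

lemma restrict_Opt: "f \<in> Opt_obj k N \<Longrightarrow> (\<lambda>x\<in>RN N. f x) = f"
  by (auto simp: Opt_obj_def PiE_def extensional_restrict)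

lemma arr_Opt_in:
  assumes "finite N" and "\<phi> \<in> N \<rightarrow>\<^sub>E M" and "f \<in> Opt_obj k N"
  shows "arr (Opt k) N M \<phi> f \<in> Opt_obj k M"
  unfolding arr_Opt[OF assms(3)]
proof (rule Opt_objI)
  show "C_diff k M (\<lambda>y. f (pullback N \<phi> y))"
    using assms by (intro C_diff_pullback) (auto simp: Opt_obj_def)
qed

lemma lax_Opt_in:
  assumes "finite N" and "finite M" and "f \<in> Opt_obj k N" and "g \<in> Opt_obj k M"
  shows "lax (Opt k) N M (f, g) \<in> Opt_obj k (N \<uplus> M)"
  unfolding lax_Opt[OF assms(3,4)]
proof (rule Opt_objI)
  have "C_nat n N f" "C_nat n M g" if "enat n \<le> k" for n
    using that assms by (auto simp: Opt_obj_def C_diff_def)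
  then show "C_diff k (N \<uplus> M) (\<lambda>z. f (pullback N (inclL N) z) + g (pullback M (inclR M) z))"
    using assms by (auto simp: C_diff_def intro!: C_nat_add C_nat_pullback)
qed

lemma lax_unit_Opt_in: "lax_unit (Opt k) () \<in> Opt_obj k {}"
  unfolding lax_unit_Opt by (rule Opt_objI) (simp add: C_diff_def)


text \<open>
  The coherence laws of \<open>Opt\<close> are equations between members of \<open>Opt_obj\<close>.  Evaluating both sides
  at a point turns them into the laws of pullbacks above.
\<close>

lemma Opt_eqI:
  assumes "f \<in> Opt_obj k N" and "g \<in> Opt_obj k N" and "\<And>x. x \<in> RN N \<Longrightarrow> f x = g x"
  shows "f = g"
  using assms PiE_ext[of f "RN N" "\<lambda>_. UNIV" g] by (simp add: Opt_obj_def)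

lemma arr_Opt_apply:
  "f \<in> Opt_obj k N \<Longrightarrow> y \<in> RN M \<Longrightarrow> arr (Opt k) N M \<phi> f y = f (pullback N \<phi> y)"
  by (simp add: arr_Opt)

lemma lax_Opt_apply:
  "f \<in> Opt_obj k N \<Longrightarrow> g \<in> Opt_obj k M \<Longrightarrow> z \<in> RN (N \<uplus> M) \<Longrightarrow>
    lax (Opt k) N M (f, g) z = f (pullback N InL z) + g (pullback M InR z)"
  by (simp add: lax_Opt cong: pullback_cong)

lemma lax_unit_Opt_apply: "x \<in> RN {} \<Longrightarrow> lax_unit (Opt k) () x = 0"
  by (simp add: lax_unit_Opt)

lemmas Opt_apply = arr_Opt_apply lax_Opt_apply lax_unit_Opt_apply

lemmas Opt_in = arr_Opt_in lax_Opt_in lax_unit_Opt_in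

lemma lax_symmetric_monoidal_functor_Opt:
  "lax_symmetric_monoidal_functor (Opt k :: ('a, 'a vec \<Rightarrow> real) finset_functor)"
proof
  show "lax_unit (Opt k :: ('a, 'a vec \<Rightarrow> real) finset_functor) \<in> UNIV \<rightarrow>\<^sub>E obj (Opt k) {}"
    by (auto simp: lax_unit_Opt_in)
next
  fix N M L N' M' :: "'a pt set" and \<phi> \<psi> :: "'a pt \<Rightarrow> 'a pt" and f g h :: "'a vec \<Rightarrow> real"
  assume fin: "finite N" "finite M" "finite L" "finite N'" "finite M'"
  show "arr (Opt k) N M \<phi> \<in> obj (Opt k) N \<rightarrow>\<^sub>E obj (Opt k) M" if "\<phi> \<in> N \<rightarrow>\<^sub>E M"
    using arr_Opt_in[OF fin(1) that] by (auto simp: Opt_def)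
  show "arr (Opt k) N N (\<lambda>i\<in>N. i) = (\<lambda>x\<in>obj (Opt k) N. x)"
    by (auto simp: Opt_def pullback_id restrict_Opt cong: restrict_cong)
  show "arr (Opt k) N L (compose N \<psi> \<phi>) =
      compose (obj (Opt k) N) (arr (Opt k) M L \<psi>) (arr (Opt k) N M \<phi>)"
    if "\<phi> \<in> N \<rightarrow>\<^sub>E M" "\<psi> \<in> M \<rightarrow>\<^sub>E L"
  proof -
    from that have "pullback N (compose N \<psi> \<phi>) y = pullback N \<phi> (pullback M \<psi> y)" for y
      by (intro pullback_compose) auto
    moreover have "(\<lambda>y\<in>RN M. f (pullback N \<phi> y)) \<in> Opt_obj k M" if "f \<in> Opt_obj k N" for f
      using arr_Opt_in[OF fin(1) \<open>\<phi> \<in> N \<rightarrow>\<^sub>E M\<close> that] that by (simp add: arr_Opt)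
    ultimately show ?thesis
      by (auto simp: Opt_def compose_def cong: restrict_cong)
  qed
  show "lax (Opt k) N M \<in> obj (Opt k) N \<times> obj (Opt k) M \<rightarrow>\<^sub>E obj (Opt k) (N \<uplus> M)"
    using lax_Opt_in[OF fin(1,2)] by (auto simp: Opt_def)
  show "arr (Opt k) (N \<uplus> M) (N' \<uplus> M') (dsum_map N M \<phi> \<psi>) (lax (Opt k) N M (f, g)) =
      lax (Opt k) N' M' (arr (Opt k) N N' \<phi> f, arr (Opt k) M M' \<psi> g)"
    if "\<phi> \<in> N \<rightarrow>\<^sub>E N'" "\<psi> \<in> M \<rightarrow>\<^sub>E M'" "f \<in> obj (Opt k) N" "g \<in> obj (Opt k) M"
    using that fin
    by (intro Opt_eqI[of _ k "N' \<uplus> M'"])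
      (simp_all add: Opt_in Opt_apply dsum_map_in pullback_dsum_map[of \<phi> _ N' \<psi> _ M'])
  show "arr (Opt k) ((N \<uplus> M) \<uplus> L) (N \<uplus> (M \<uplus> L)) (associator N M L)
        (lax (Opt k) (N \<uplus> M) L (lax (Opt k) N M (f, g), h)) =
      lax (Opt k) N (M \<uplus> L) (f, lax (Opt k) M L (g, h))"
    if "f \<in> obj (Opt k) N" "g \<in> obj (Opt k) M" "h \<in> obj (Opt k) L"
    using that fin
    by (intro Opt_eqI[of _ k "N \<uplus> (M \<uplus> L)"])
      (simp_all add: Opt_in Opt_apply associator_in pullback_associator)
  show "arr (Opt k) ({} \<uplus> N) N (left_unitor N)
      (lax (Opt k) {} N (lax_unit (Opt k) (), f)) = f" if "f \<in> obj (Opt k) N"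
    using that fin
    by (intro Opt_eqI[of _ k N])
      (simp_all add: Opt_in Opt_apply left_unitor_in pullback_left_unitor)
  show "arr (Opt k) (N \<uplus> {}) N (right_unitor N)
      (lax (Opt k) N {} (f, lax_unit (Opt k) ())) = f" if "f \<in> obj (Opt k) N"
    using that fin
    by (intro Opt_eqI[of _ k N])
      (simp_all add: Opt_in Opt_apply right_unitor_in pullback_right_unitor)
  show "arr (Opt k) (N \<uplus> M) (M \<uplus> N) (symmetry N M) (lax (Opt k) N M (f, g)) =
      lax (Opt k) M N (g, f)" if "f \<in> obj (Opt k) N" "g \<in> obj (Opt k) M"
    using that fin
    by (intro Opt_eqI[of _ k "M \<uplus> N"])
      (simp_all add: Opt_in Opt_apply symmetry_in add.commute pullback_symmetry)
qed


section \<open>The functor Dynam\<close>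

lemma obj_Dynam [simp]: "obj (Dynam k) = Dynam_obj k"
  by (simp add: Dynam_def)

lemma Dynam_obj_apply_in: "\<upsilon> \<in> Dynam_obj k N \<Longrightarrow> x \<in> RN N \<Longrightarrow> \<upsilon> x \<in> RN N"
  by (auto simp: Dynam_obj_def)

text \<open>
  The components of a vector field are usually known only on \<open>RN N\<close>, where they agree with functions
  \<open>w i\<close> whose class is easy to see.
\<close>

lemma Dynam_objI:
  assumes "\<upsilon> \<in> extensional (RN N)" and "\<And>x. x \<in> RN N \<Longrightarrow> \<upsilon> x \<in> RN N"
    and "\<And>x i. x \<in> RN N \<Longrightarrow> i \<in> N \<Longrightarrow> \<upsilon> x i = w i x"
    and "\<And>i. i \<in> N \<Longrightarrow> C_diff k N (w i)"
  shows "\<upsilon> \<in> Dynam_obj k N"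
proof -
  have "C_diff k N (\<lambda>x. \<upsilon> x i)" if "i \<in> N" for i
    using assms(4)[OF that] C_diff_cong[of N "\<lambda>x. \<upsilon> x i" "w i" k] assms(3) that by blast
  with assms(1,2) show ?thesis
    by (auto simp: Dynam_obj_def PiE_def)
qed

lemma Dynam_eqI:
  assumes "\<upsilon> \<in> Dynam_obj k N" and "\<rho> \<in> Dynam_obj k N" and "\<And>x. x \<in> RN N \<Longrightarrow> \<upsilon> x = \<rho> x"
  shows "\<upsilon> = \<rho>"
  using assms PiE_ext[of \<upsilon> "RN N" "\<lambda>_. RN N" \<rho>] by (simp add: Dynam_obj_def)

lemma arr_Dynam_apply:
  "\<upsilon> \<in> Dynam_obj k N \<Longrightarrow> y \<in> RN M \<Longrightarrow>
    arr (Dynam k) N M \<phi> \<upsilon> y = pushforward N M \<phi> (\<upsilon> (pullback N \<phi> y))"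
  by (simp add: Dynam_def)

lemma pushforward_inclusions:
  "(\<lambda>p\<in>N \<uplus> M. pushforward N (N \<uplus> M) (inclL N) u p + pushforward M (N \<uplus> M) (inclR M) v p) =
    join N M u v"
proof (rule RN_eqI[of _ "N \<uplus> M"])
  fix p assume p: "p \<in> N \<uplus> M"
  have "{i \<in> N. inclL N i = p} = {i \<in> N. InL i = p}" "{i \<in> M. inclR M i = p} = {i \<in> M. InR i = p}"
    by (auto simp: inclL_def inclR_def)
  with p show "(\<lambda>p\<in>N \<uplus> M. pushforward N (N \<uplus> M) (inclL N) u p +
      pushforward M (N \<uplus> M) (inclR M) v p) p = join N M u v p"
    by (auto simp: pushforward_def elim!: dsum_cases)
qed (simp_all add: join_def RN_def)

lemma lax_Dynam_apply:
  "\<upsilon> \<in> Dynam_obj k N \<Longrightarrow> \<rho> \<in> Dynam_obj k M \<Longrightarrow> z \<in> RN (N \<uplus> M) \<Longrightarrow>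
    lax (Dynam k) N M (\<upsilon>, \<rho>) z = join N M (\<upsilon> (pullback N InL z)) (\<rho> (pullback M InR z))"
  by (simp add: Dynam_def pushforward_inclusions cong: pullback_cong)

lemma lax_unit_Dynam: "lax_unit (Dynam k) () = (\<lambda>x\<in>RN {}. x)"
  by (simp add: Dynam_def)

lemma arr_Dynam_in:
  assumes "finite N" and "\<phi> \<in> N \<rightarrow>\<^sub>E M" and \<upsilon>: "\<upsilon> \<in> Dynam_obj k N"
  shows "arr (Dynam k) N M \<phi> \<upsilon> \<in> Dynam_obj k M"
proof (rule Dynam_objI[where w = "\<lambda>j y. \<Sum>i\<in>{i\<in>N. \<phi> i = j}. \<upsilon> (pullback N \<phi> y) i"])
  fix j
  have "C_nat n N (\<lambda>x. \<upsilon> x i)" if "i \<in> N" "enat n \<le> k" for i n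
    using \<upsilon> that by (auto simp: Dynam_obj_def C_diff_def)
  then show "C_diff k M (\<lambda>y. \<Sum>i\<in>{i\<in>N. \<phi> i = j}. \<upsilon> (pullback N \<phi> y) i)"
    unfolding C_diff_def using assms(1,2)
    by (auto intro!: C_nat_sum C_nat_pullback[where f = "\<lambda>x. \<upsilon> x _"])
qed (use \<upsilon> in \<open>simp_all add: arr_Dynam_apply, simp_all add: Dynam_def pushforward_def\<close>)

lemma lax_Dynam_in:
  assumes "finite N" and "finite M" and \<upsilon>: "\<upsilon> \<in> Dynam_obj k N" and \<rho>: "\<rho> \<in> Dynam_obj k M"
  shows "lax (Dynam k) N M (\<upsilon>, \<rho>) \<in> Dynam_obj k (N \<uplus> M)"
proof (rule Dynam_objI[where
      w = "\<lambda>p z. join N M (\<upsilon> (pullback N InL z)) (\<rho> (pullback M InR z)) p"])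
  fix p assume "p \<in> N \<uplus> M"
  then show "C_diff k (N \<uplus> M)
    (\<lambda>z. join N M (\<upsilon> (pullback N InL z)) (\<rho> (pullback M InR z)) p)"
  proof (cases rule: dsum_cases)
    case (InL i)
    then have "C_diff k N (\<lambda>x. \<upsilon> x i)"
      using \<upsilon> by (simp add: Dynam_obj_def)
    then show ?thesis
      using InL \<open>finite N\<close> by (auto intro: C_diff_pullback[where f = "\<lambda>x. \<upsilon> x i"])
  next
    case (InR j)
    then have "C_diff k M (\<lambda>x. \<rho> x j)"
      using \<rho> by (simp add: Dynam_obj_def)
    then show ?thesis
      using InR \<open>finite M\<close> by (auto intro: C_diff_pullback[where f = "\<lambda>x. \<rho> x j"])
  qed
qed (use \<upsilon> \<rho> in \<open>simp_all add: lax_Dynam_apply, simp_all add: Dynam_def\<close>)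

lemma lax_unit_Dynam_in: "lax_unit (Dynam k) () \<in> Dynam_obj k {}"
  by (simp add: lax_unit_Dynam Dynam_obj_empty)

lemmas Dynam_apply = arr_Dynam_apply lax_Dynam_apply Dynam_obj_apply_in

lemmas Dynam_in = arr_Dynam_in lax_Dynam_in lax_unit_Dynam_in

lemma lax_symmetric_monoidal_functor_Dynam:
  "lax_symmetric_monoidal_functor (Dynam k :: ('a, 'a vec \<Rightarrow> 'a vec) finset_functor)"
proof
  show "lax_unit (Dynam k :: ('a, 'a vec \<Rightarrow> 'a vec) finset_functor) \<in> UNIV \<rightarrow>\<^sub>E obj (Dynam k) {}"
    by (auto simp: lax_unit_Dynam_in)
next
  fix N M L N' M' :: "'a pt set" and \<phi> \<psi> :: "'a pt \<Rightarrow> 'a pt" and f g h :: "'a vec \<Rightarrow> 'a vec"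
  assume fin: "finite N" "finite M" "finite L" "finite N'" "finite M'"
  show "arr (Dynam k) N M \<phi> \<in> obj (Dynam k) N \<rightarrow>\<^sub>E obj (Dynam k) M" if "\<phi> \<in> N \<rightarrow>\<^sub>E M"
    using arr_Dynam_in[OF fin(1) that] by (auto simp: Dynam_def)
  have "arr (Dynam k) N N (\<lambda>i\<in>N. i) f = f" if "f \<in> Dynam_obj k N" for f
    using that fin
    by (intro Dynam_eqI[of _ k N]) (simp_all add: Dynam_in Dynam_apply pullback_id pushforward_id)
  then show "arr (Dynam k) N N (\<lambda>i\<in>N. i) = (\<lambda>x\<in>obj (Dynam k) N. x)"
    by (auto simp: Dynam_def)
  show "arr (Dynam k) N L (compose N \<psi> \<phi>) =
      compose (obj (Dynam k) N) (arr (Dynam k) M L \<psi>) (arr (Dynam k) N M \<phi>)"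
    if \<phi>: "\<phi> \<in> N \<rightarrow>\<^sub>E M" and \<psi>: "\<psi> \<in> M \<rightarrow>\<^sub>E L"
  proof -
    have "compose N \<psi> \<phi> \<in> N \<rightarrow>\<^sub>E L"
      using \<phi> \<psi> by (auto simp: compose_def)
    then have "arr (Dynam k) N L (compose N \<psi> \<phi>) f = arr (Dynam k) M L \<psi> (arr (Dynam k) N M \<phi> f)"
      if "f \<in> Dynam_obj k N" for f
      using that fin \<phi> \<psi>
      by (intro Dynam_eqI[of _ k L])
        (simp_all add: Dynam_in Dynam_apply pullback_compose[of \<phi> N M]
          pushforward_compose[of N M \<phi>] PiE_def)
    then show ?thesis
      by (auto simp: Dynam_def compose_def)
  qed
  show "lax (Dynam k) N M \<in> obj (Dynam k) N \<times> obj (Dynam k) M \<rightarrow>\<^sub>E obj (Dynam k) (N \<uplus> M)"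
    using lax_Dynam_in[OF fin(1,2)] by (auto simp: Dynam_def)
  show "arr (Dynam k) (N \<uplus> M) (N' \<uplus> M') (dsum_map N M \<phi> \<psi>) (lax (Dynam k) N M (f, g)) =
      lax (Dynam k) N' M' (arr (Dynam k) N N' \<phi> f, arr (Dynam k) M M' \<psi> g)"
    if "\<phi> \<in> N \<rightarrow>\<^sub>E N'" "\<psi> \<in> M \<rightarrow>\<^sub>E M'" "f \<in> obj (Dynam k) N" "g \<in> obj (Dynam k) M"
    using that fin
    by (intro Dynam_eqI[of _ k "N' \<uplus> M'"])
      (simp_all add: Dynam_in Dynam_apply dsum_map_in pushforward_dsum_map
        pullback_dsum_map[of \<phi> _ N' \<psi> _ M'])
  show "arr (Dynam k) ((N \<uplus> M) \<uplus> L) (N \<uplus> (M \<uplus> L)) (associator N M L)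
        (lax (Dynam k) (N \<uplus> M) L (lax (Dynam k) N M (f, g), h)) =
      lax (Dynam k) N (M \<uplus> L) (f, lax (Dynam k) M L (g, h))"
    if "f \<in> obj (Dynam k) N" "g \<in> obj (Dynam k) M" "h \<in> obj (Dynam k) L"
    using that fin
    by (intro Dynam_eqI[of _ k "N \<uplus> (M \<uplus> L)"])
      (simp_all add: Dynam_in Dynam_apply associator_in pushforward_associator pullback_associator)
  show "arr (Dynam k) ({} \<uplus> N) N (left_unitor N)
      (lax (Dynam k) {} N (lax_unit (Dynam k) (), f)) = f" if "f \<in> obj (Dynam k) N"
    using that fin
    by (intro Dynam_eqI[of _ k N])
      (simp_all add: Dynam_in Dynam_apply left_unitor_in pushforward_left_unitor pullback_left_unitor)
  show "arr (Dynam k) (N \<uplus> {}) N (right_unitor N)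
      (lax (Dynam k) N {} (f, lax_unit (Dynam k) ())) = f" if "f \<in> obj (Dynam k) N"
    using that fin
    by (intro Dynam_eqI[of _ k N])
      (simp_all add: Dynam_in Dynam_apply right_unitor_in pushforward_right_unitor
        pullback_right_unitor)
  show "arr (Dynam k) (N \<uplus> M) (M \<uplus> N) (symmetry N M) (lax (Dynam k) N M (f, g)) =
      lax (Dynam k) M N (g, f)" if "f \<in> obj (Dynam k) N" "g \<in> obj (Dynam k) M"
    using that fin
    by (intro Dynam_eqI[of _ k "M \<uplus> N"])
      (simp_all add: Dynam_in Dynam_apply symmetry_in pushforward_symmetry pullback_symmetry)
qed


section \<open>The gradient flow\<close>

lemma flow_apply:
  "f \<in> Opt_obj k N \<Longrightarrow> x \<in> RN N \<Longrightarrow> flow k N f x = (\<lambda>i\<in>N. - partial_deriv i f x)"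
  by (auto simp: flow_def gradient_def)

lemma flow_in:
  assumes "f \<in> Opt_obj (k + 1) N"
  shows "flow (k + 1) N f \<in> Dynam_obj k N"
proof (rule Dynam_objI[where w = "\<lambda>i x. - partial_deriv i f x"])
  fix i assume "i \<in> N"
  then have "C_diff k N (partial_deriv i f)"
    using assms by (auto simp: Opt_obj_def intro: C_diff_partial_deriv)
  then show "C_diff k N (\<lambda>x. - partial_deriv i f x)"
    by (auto simp: C_diff_def intro: C_nat_minus)
qed (use assms in \<open>simp_all add: flow_apply, simp_all add: flow_def RN_def\<close>)

text \<open>
  Naturality: the chain rule, with the sum over a fibre read as a component of the pushforward.
\<close>

lemma flow_arr:
  assumes "finite N" and \<phi>: "\<phi> \<in> N \<rightarrow>\<^sub>E M" and f: "f \<in> Opt_obj (k + 1) N"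
  shows "flow (k + 1) M (arr (Opt (k + 1)) N M \<phi> f) = arr (Dynam k) N M \<phi> (flow (k + 1) N f)"
proof (rule Dynam_eqI)
  fix y :: "'a vec" assume y: "y \<in> RN M"
  have C1: "C_nat (Suc 0) N f"
    using f C_diff_imp_C_1 by (auto simp: Opt_obj_def)
  have "partial_deriv j (arr (Opt (k + 1)) N M \<phi> f) y =
      (\<Sum>i\<in>{i\<in>N. \<phi> i = j}. partial_deriv i f (pullback N \<phi> y))" if "j \<in> M" for j
  proof -
    have "partial_deriv j (arr (Opt (k + 1)) N M \<phi> f) y =
        partial_deriv j (\<lambda>y. f (pullback N \<phi> y)) y"
      by (rule partial_deriv_cong[OF _ that y]) (simp add: arr_Opt_apply f)
    also have "\<dots> = (\<Sum>i\<in>{i\<in>N. \<phi> i = j}. partial_deriv i f (pullback N \<phi> y))"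
      by (rule partial_deriv_pullback[OF C1 \<open>finite N\<close>])
    finally show ?thesis .
  qed
  then show "flow (k + 1) M (arr (Opt (k + 1)) N M \<phi> f) y =
      arr (Dynam k) N M \<phi> (flow (k + 1) N f) y"
    using assms y
    by (auto simp: arr_Dynam_apply flow_in flow_apply arr_Opt_in pushforward_def sum_negf restrict_def)
qed (use assms in \<open>auto intro!: flow_in arr_Opt_in arr_Dynam_in\<close>)

text \<open>
  The fibres of \<open>InL\<close> and \<open>InR\<close> over a point \<open>p\<close> of the disjoint union are a singleton and the empty
  set, in an order that depends on the summand containing \<open>p\<close>.
\<close>

lemma flow_lax:
  assumes fin: "finite N" "finite M" and f: "f \<in> Opt_obj (k + 1) N" and g: "g \<in> Opt_obj (k + 1) M"
  shows "flow (k + 1) (N \<uplus> M) (lax (Opt (k + 1)) N M (f, g)) =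
    lax (Dynam k) N M (flow (k + 1) N f, flow (k + 1) M g)"
proof (rule Dynam_eqI)
  fix z :: "'a vec" assume z: "z \<in> RN (N \<uplus> M)"
  have C1: "C_nat (Suc 0) N f" "C_nat (Suc 0) M g"
    using f g C_diff_imp_C_1 by (auto simp: Opt_obj_def)
  have *: "partial_deriv p (lax (Opt (k + 1)) N M (f, g)) z =
      (\<Sum>i\<in>{i\<in>N. InL i = p}. partial_deriv i f (pullback N InL z)) +
      (\<Sum>j\<in>{j\<in>M. InR j = p}. partial_deriv j g (pullback M InR z))" if "p \<in> N \<uplus> M" for p
  proof -
    have "partial_deriv p (lax (Opt (k + 1)) N M (f, g)) z =
        partial_deriv p (\<lambda>z. f (pullback N InL z) + g (pullback M InR z)) z"
      by (rule partial_deriv_cong[OF _ that z]) (simp add: lax_Opt_apply f g)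
    also have "\<dots> = (\<Sum>i\<in>{i\<in>N. InL i = p}. partial_deriv i f (pullback N InL z)) +
      (\<Sum>j\<in>{j\<in>M. InR j = p}. partial_deriv j g (pullback M InR z))"
      unfolding partial_deriv_def[of p]
      by (rule DERIV_imp_deriv, rule DERIV_add)
        (rule DERIV_pullback[OF C1(1) fin(1)], rule DERIV_pullback[OF C1(2) fin(2)])
    finally show ?thesis .
  qed
  show "flow (k + 1) (N \<uplus> M) (lax (Opt (k + 1)) N M (f, g)) z =
    lax (Dynam k) N M (flow (k + 1) N f, flow (k + 1) M g) z"
  proof (rule RN_eqI)
    fix p assume p: "p \<in> N \<uplus> M"
    with z have "flow (k + 1) (N \<uplus> M) (lax (Opt (k + 1)) N M (f, g)) z p =
      - partial_deriv p (lax (Opt (k + 1)) N M (f, g)) z"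
      by (simp add: flow_apply lax_Opt_in fin f g)
    also have "\<dots> = join N M (flow (k + 1) N f (pullback N InL z))
        (flow (k + 1) M g (pullback M InR z)) p"
      using p unfolding *[OF p] by (auto simp: flow_apply f g elim!: dsum_cases)
    finally show "flow (k + 1) (N \<uplus> M) (lax (Opt (k + 1)) N M (f, g)) z p =
      lax (Dynam k) N M (flow (k + 1) N f, flow (k + 1) M g) z p"
      using z by (simp add: lax_Dynam_apply flow_in f g)
  qed (use z fin f g in \<open>simp_all add: flow_in lax_Opt_in lax_Dynam_apply,
      simp add: flow_apply lax_Opt_in RN_def\<close>)
qed (use assms in \<open>auto intro!: flow_in lax_Opt_in lax_Dynam_in\<close>)

theorem theorem3p3:
  fixes k :: enat
  shows "monoidal_natural_transformation
           (Opt (k + 1) :: ('a, 'a vec \<Rightarrow> real) finset_functor) (Dynam k) (flow (k + 1))"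
proof (intro monoidal_natural_transformation.intro monoidal_natural_transformation_axioms.intro
    lax_symmetric_monoidal_functor_Opt lax_symmetric_monoidal_functor_Dynam)
  fix N M :: "'a pt set" and \<phi> :: "'a pt \<Rightarrow> 'a pt" and f g :: "'a vec \<Rightarrow> real"
  assume fin: "finite N" "finite M"
  show "flow (k + 1) N \<in> obj (Opt (k + 1)) N \<rightarrow>\<^sub>E obj (Dynam k) N"
    by (rule PiE_I) (simp_all add: flow_in, simp add: flow_def)
  show "compose (obj (Opt (k + 1)) N) (flow (k + 1) M) (arr (Opt (k + 1)) N M \<phi>) =
      compose (obj (Opt (k + 1)) N) (arr (Dynam k) N M \<phi>) (flow (k + 1) N)" if "\<phi> \<in> N \<rightarrow>\<^sub>E M"
    using flow_arr[OF fin(1) that] by (auto simp: compose_def cong: restrict_cong)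
  show "flow (k + 1) (N \<uplus> M) (lax (Opt (k + 1)) N M (f, g)) =
      lax (Dynam k) N M (flow (k + 1) N f, flow (k + 1) M g)"
    if "f \<in> obj (Opt (k + 1)) N" "g \<in> obj (Opt (k + 1)) M"
    using that fin by (auto intro: flow_lax)
next
  have "flow (k + 1) {} (lax_unit (Opt (k + 1)) ()) \<in> Dynam_obj k {}"
    by (intro flow_in lax_unit_Opt_in)
  then show "flow (k + 1) {} (lax_unit (Opt (k + 1)) ()) =
      lax_unit (Dynam k :: ('a, 'a vec \<Rightarrow> 'a vec) finset_functor) ()"
    by (simp add: Dynam_obj_empty lax_unit_Dynam)
qed

end
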